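(* Let $1\le t\le r\le n$, $0\le s\le n-r$, $\tau>0$, $g=\tau\ell_2$ on $\mathbb R^n$, $z_v\in\mathbb R$, $\gamma=1$, and let $\tilde z\in\mathbb R^{r-t+1}_{\ge0}$ be sorted in descending order. Put $c_1:=\sum_{i=1}^{r-t}\tilde z_i^2$ and $c_2:=\sqrt{t+s}\,\tilde z_{r-t+1}$. Let $(\tilde y,\tilde w)\in\mathbb R^{r-t+1}\times\mathbb R$ fulfill one of the cases (C1), (C2), (C3) of the context. (1) Let $f(w)=\frac12(w+z_v)^2$. Then (C1) and (C2) become $$(\tilde y,\tilde w)=(\tilde z,-z_v)\iff\sqrt{\sum_{i=1}^{r-t}\tilde z_i^2+\frac{t}{s+t}\tilde z_{r-t+1}^2}\le-\tau z_v,$$ $$(\tilde y,\tilde w)=0\iff\sqrt{\sum_{i=1}^{r-t}\tilde z_i^2+\frac{s+t}{t}\tilde z_{r-t+1}^2}\le\frac{z_v}{\tau},$$ and in the remaining case (C3), when neither inequality holds, $$\tilde y_i=\frac{\tilde z_i}{1+\frac{\mu}{\tau^2\tilde w}}\ (1\le i\le r-t),\qquad \tilde y_{r-t+1}=\frac{\tilde z_{r-t+1}}{1+\frac{\mu t}{\tau^2\tilde w(s+t)}},\qquad \tilde w=\mu-z_v,$$ where the unique $\mu\ge0$ (the multiplier in (C3)) is a solution of the fourth order polynomial equation $$\Big[\Big(\tilde w\tau+\frac{\mu}{\tau}\Big)^2-c_1\Big]\Big[(t+s)\tau\tilde w+\frac{\mu}{\tau}t\Big]^2-t\,c_2^2\Big(\tilde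 w\tau+\frac{\mu}{\tau}\Big)^2=0\qquad(\ast)$$ with $\tilde w=\mu-z_v$. (2) Let $f(w)=\chi_{[0,\gamma]}(w)$ (with $\gamma=1$). Then (C1) and (C2) reduce to the first equivalence in (1) with $z_v=-1$, i.e. $(\tilde y,\tilde w)=(\tilde z,1)$ if and only if $\sqrt{\sum_{i=1}^{r-t}\tilde z_i^2+\frac{t}{s+t}\tilde z_{r-t+1}^2}\le\tau$; and otherwise (C3) is determined by $\tilde w=1$, $$\tilde y_i=\frac{\tilde z_i}{1+\frac{\mu}{\tau^2}}\ (1\le i\le r-t),\qquad \tilde y_{r-t+1}=\frac{\tilde z_{r-t+1}}{1+\frac{\mu t}{\tau^2(s+t)}},$$ and by $(\ast)$ with $\tilde w=1$, i.e. by $$\Big[\Big(\tau+\frac{\mu}{\tau}\Big)^2-c_1\Big]\Big[(t+s)\tau+\frac{\mu}{\tau}t\Big]^2-t\,c_2^2\Big(\tau+\frac{\mu}{\tau}\Big)^2=0.$$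
   Context: $\ell_2$ is the Euclidean norm, $g^D$ the dual norm of $g$ (here $g^D=\ell_2/\tau$), $\partial$ the convex subdifferential, and $\chi_{[0,\gamma]}$ is the indicator function ($0$ on $[0,\gamma]$, $+\infty$ elsewhere). For a symmetric gauge function $g$ on $\mathbb R^n$ and $x\in\mathbb R^{r-t+1}$: $$g^D_{r,s,t}(x):=g^D\Big(x_1,\dots,x_{r-t},\underbrace{\tfrac{x_{r-t+1}}{\sqrt{t+s}},\dots,\tfrac{x_{r-t+1}}{\sqrt{t+s}}}_{t\text{ times}},0,\dots,0\Big),$$ $$g_{r,s,t}(x):=g\Big(x_1,\dots,x_{r-t},\underbrace{\tfrac{\sqrt{t+s}}{t}x_{r-t+1},\dots,\tfrac{\sqrt{t+s}}{t}x_{r-t+1}}_{t\text{ times}},0,\dots,0\Big).$$ The cases, for a proper closed convex $f:\mathbb R\to\mathbb R\cup\{\infty\}$ and $\gamma>0$, are: (C1) $\tilde y=\tilde z$, $\tilde w=\operatorname{argmin}_wf(w)$ and $\tilde w\ge g^D_{r,s,t}(\tilde z)$. For $f=\chi_{[0,1]}$, whose minimizer is not unique, the minimizer is taken to be $\tilde w=1$. (C2) $(\tilde y,\tilde w)=0$, where $g_{r,s,t}(\tilde z)\le\mu/\gamma$ for some $\mu\in\partial f(0)$. For $f=\chi_{[0,1]}$ this case only arises for $\tilde z=0$ and is subsumed in (C1). (C3) $\gamma(\tilde z-\tilde y)\in\mu\,\partial g^D_{r,s,t}(\tilde y)$ for some $\mu\in\partial f(\tilde w)\cap\mathbb R_{\ge0}$,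 and $\tilde w=g^D_{r,s,t}(\tilde y)$. These cases describe the solution of: minimize $f(w)+\frac{\gamma}{2}\sum_{i=1}^{r-t+1}(x_i-\tilde z_i)^2$ over $x\in\mathbb R^{r-t+1}$, $w\in\mathbb R$ subject to $w\ge g^D_{r,s,t}(x)$.
   Formalization: In part (2), (C1) is given precedence: (C2) or (C3) is allowed only when no pair fulfills (C1). Without this the claim fails: for z̃=0 the pair (0,0) fulfills (C3) with μ=0, the inequality holds, but w̃ is not 1. *)

theory Defs
  imports
    "HOL-Library.Extended_Real"
    "HOL-Analysis.L2_Norm"
    "Jordan_Normal_Form.Matrix"
begin

text \<open>
  Vectors of \<open>\<real>\<^sup>d\<close> are elements of \<open>carrier_vec d\<close>. Indices start at 0, so the
  component \<open>x\<^sub>i\<close> of the usual 1-based notation is \<open>x $ (i - 1)\<close>; in particular the last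
  component of \<open>x \<in> carrier_vec (r - t + 1)\<close> is \<open>x $ (r - t)\<close>.
\<close>

definition l2 :: "real vec \<Rightarrow> real" where
  "l2 x = L2_set (\<lambda>i. x $ i) {..<dim_vec x}"

definition dual_norm :: "nat \<Rightarrow> (real vec \<Rightarrow> real) \<Rightarrow> real vec \<Rightarrow> real" where
  "dual_norm n g x = Sup {x \<bullet> v |v. v \<in> carrier_vec n \<and> g v \<le> 1}"

definition dual_rst ::
    "nat \<Rightarrow> nat \<Rightarrow> nat \<Rightarrow> nat \<Rightarrow> (real vec \<Rightarrow> real) \<Rightarrow> real vec \<Rightarrow> real" where
  "dual_rst n r s t g x = dual_norm n g
     (vec n (\<lambda>i. if i < r - t then x $ i
                 else if i < r then x $ (r - t) / sqrt (real (t + s))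
                 else 0))"

definition primal_rst ::
    "nat \<Rightarrow> nat \<Rightarrow> nat \<Rightarrow> nat \<Rightarrow> (real vec \<Rightarrow> real) \<Rightarrow> real vec \<Rightarrow> real" where
  "primal_rst n r s t g x = g
     (vec n (\<lambda>i. if i < r - t then x $ i
                 else if i < r then sqrt (real (t + s)) / real t * x $ (r - t)
                 else 0))"

text \<open>
  The convex subdifferentials of a proper extended-real function on the line (automatically empty
  outside the effective domain) and of a finite function on \<open>\<real>\<^sup>d\<close>.
\<close>

definition subdiff :: "(real \<Rightarrow> ereal) \<Rightarrow> real \<Rightarrow> real set" where
  "subdiff f w = {\<mu>. \<forall>v. f w + ereal (\<mu> * (v - w)) \<le> f v}"

definition subdiff_vec :: "nat \<Rightarrow> (real vec \<Rightarrow> real) \<Rightarrow> real vec \<Rightarrow> real vec set" where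
  "subdiff_vec d h x =
     {p \<in> carrier_vec d. \<forall>v \<in> carrier_vec d. h x + p \<bullet> (v - x) \<le> h v}"

definition convex_indicator :: "real set \<Rightarrow> real \<Rightarrow> ereal" where
  "convex_indicator S w = (if w \<in> S then 0 else \<infinity>)"

definition shifted_square :: "real \<Rightarrow> real \<Rightarrow> ereal" where
  "shifted_square zv w = ereal (1 / 2 * (w + zv)\<^sup>2)"

text \<open>
  The minimizer of \<open>f\<close>; among several minimizers the largest one is chosen, so that the
  minimizer of \<open>convex_indicator {0..1}\<close> is 1.
\<close>

definition is_argmin :: "(real \<Rightarrow> ereal) \<Rightarrow> real \<Rightarrow> bool" where
  "is_argmin f w \<longleftrightarrow> is_arg_min f (\<lambda>_. True) w \<and> (\<forall>v. is_arg_min f (\<lambda>_. True) v \<longrightarrow> v \<le> w)"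

text \<open>
  The cases for the solution of: minimize \<open>f w + \<gamma> / 2 * (\<Sum>i<r-t+1. (x $ i - z $ i)\<^sup>2)\<close>
  subject to \<open>w \<ge> dual_rst n r s t g x\<close>.
\<close>

definition case_C1 ::
    "nat \<Rightarrow> nat \<Rightarrow> nat \<Rightarrow> nat \<Rightarrow> (real vec \<Rightarrow> real) \<Rightarrow> (real \<Rightarrow> ereal) \<Rightarrow>
     real vec \<Rightarrow> real vec \<Rightarrow> real \<Rightarrow> bool" where
  "case_C1 n r s t g f z y w \<longleftrightarrow> y = z \<and> is_argmin f w \<and> w \<ge> dual_rst n r s t g z"

definition case_C2 ::
    "nat \<Rightarrow> nat \<Rightarrow> nat \<Rightarrow> nat \<Rightarrow> (real vec \<Rightarrow> real) \<Rightarrow> (real \<Rightarrow> ereal) \<Rightarrow> real \<Rightarrow>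
     real vec \<Rightarrow> real vec \<Rightarrow> real \<Rightarrow> bool" where
  "case_C2 n r s t g f \<gamma> z y w \<longleftrightarrow>
     y = 0\<^sub>v (r - t + 1) \<and> w = 0 \<and> (\<exists>\<mu> \<in> subdiff f 0. primal_rst n r s t g z \<le> \<mu> / \<gamma>)"

definition multiplier_C3 ::
    "nat \<Rightarrow> nat \<Rightarrow> nat \<Rightarrow> nat \<Rightarrow> (real vec \<Rightarrow> real) \<Rightarrow> (real \<Rightarrow> ereal) \<Rightarrow> real \<Rightarrow>
     real vec \<Rightarrow> real vec \<Rightarrow> real \<Rightarrow> real \<Rightarrow> bool" where
  "multiplier_C3 n r s t g f \<gamma> z y w \<mu> \<longleftrightarrow>
     \<mu> \<in> subdiff f w \<and> \<mu> \<ge> 0 \<and>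
     \<gamma> \<cdot>\<^sub>v (z - y) \<in> (\<lambda>p. \<mu> \<cdot>\<^sub>v p) ` subdiff_vec (r - t + 1) (dual_rst n r s t g) y \<and>
     w = dual_rst n r s t g y"

definition case_C3 ::
    "nat \<Rightarrow> nat \<Rightarrow> nat \<Rightarrow> nat \<Rightarrow> (real vec \<Rightarrow> real) \<Rightarrow> (real \<Rightarrow> ereal) \<Rightarrow> real \<Rightarrow>
     real vec \<Rightarrow> real vec \<Rightarrow> real \<Rightarrow> bool" where
  "case_C3 n r s t g f \<gamma> z y w \<longleftrightarrow> (\<exists>\<mu>. multiplier_C3 n r s t g f \<gamma> z y w \<mu>)"

text \<open>
  For a minimizer that is not unique, (C1) and (C3) overlap: if
  \<open>f = convex_indicator {0..1}\<close> and \<open>dual_rst n r s t g z < 1\<close>, the pair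
  \<open>(z, dual_rst n r s t g z)\<close> satisfies (C3) with multiplier 0, and so does \<open>(0, 0)\<close>
  satisfy (C2) if \<open>z = 0\<close>. Choosing the minimizer 1 amounts to giving (C1) precedence.
\<close>

definition cases_C1_first ::
    "nat \<Rightarrow> nat \<Rightarrow> nat \<Rightarrow> nat \<Rightarrow> (real vec \<Rightarrow> real) \<Rightarrow> (real \<Rightarrow> ereal) \<Rightarrow> real \<Rightarrow>
     real vec \<Rightarrow> real vec \<Rightarrow> real \<Rightarrow> bool" where
  "cases_C1_first n r s t g f \<gamma> z y w \<longleftrightarrow>
     case_C1 n r s t g f z y w \<or>
     (\<nexists>y' w'. case_C1 n r s t g f z y' w') \<and>
       (case_C2 n r s t g f \<gamma> z y w \<or> case_C3 n r s t g f \<gamma> z y w)"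

text \<open>The left-hand side of the quartic equation for \<open>\<mu>\<close>.\<close>

definition quartic :: "real \<Rightarrow> nat \<Rightarrow> nat \<Rightarrow> real \<Rightarrow> real \<Rightarrow> real \<Rightarrow> real \<Rightarrow> real" where
  "quartic \<tau> s t c1 c2 w \<mu> =
     ((w * \<tau> + \<mu> / \<tau>)\<^sup>2 - c1) * (real (t + s) * \<tau> * w + \<mu> / \<tau> * real t)\<^sup>2
       - real t * c2\<^sup>2 * (w * \<tau> + \<mu> / \<tau>)\<^sup>2"

end

theory Submission
  imports Defs
begin

text \<open>
  Write \<open>m = r - t\<close> and \<open>\<kappa> = t / (s + t)\<close>. Repeating the last entry \<open>t\<close> times only changes its
  weight, so for \<open>g = \<tau> * l2\<close> everything lives on \<open>\<real>\<^bsup>m + 1\<^esup>\<close> with a weighted Euclidean norm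
  \<open>N\<^sub>\<kappa> x = sqrt (x\<^sub>1\<^sup>2 + \<dots> + x\<^sub>m\<^sup>2 + \<kappa> x\<^bsub>m+1\<^esub>\<^sup>2)\<close>: the function in the constraint is \<open>D = N\<^sub>\<kappa> / \<tau>\<close>,
  and the one in (C2) is \<open>\<tau> * N\<^bsub>1/\<kappa>\<^esub>\<close>, its dual (\<open>dual_rst_scaled_l2\<close>, \<open>primal_rst_scaled_l2\<close>,
  \<open>scalar_prod_le_weighted_norms\<close>).

  A subgradient \<open>p\<close> of \<open>D\<close> at \<open>y\<close> satisfies \<open>p \<bullet> y = D y\<close> and has dual norm at most 1, which is the
  equality case of the Cauchy-Schwarz inequality and, for \<open>y \<noteq> 0\<close>, forces \<open>p\<close> to be a multiple of
  \<open>(y\<^sub>1, \<dots>, y\<^sub>m, \<kappa> y\<^bsub>m+1\<^esub>)\<close> (\<open>subgradient_weighted_norm_components\<close>). Hence \<open>z - y = \<mu> p\<close> reads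
  componentwise as the shrinkage formulas for \<open>y\<close>, and substituting them into \<open>D y = w\<close> gives the
  quartic equation (\<open>multiplier_C3_solution\<close>).

  For the quadratic \<open>f\<close> each of the three cases is a form of the optimality condition, expressed as
  a variational inequality, of one strongly convex problem
  (\<open>cases_shifted_square_imp_variational_solution\<close>). The solution of that inequality is unique
  (\<open>variational_solution_unique\<close>), so as soon as one of the two inequalities of the theorem makes
  \<open>(z, - zv)\<close> or \<open>0\<close> a solution, the given pair must be that one; the multiplier \<open>w + zv\<close> inherits
  the uniqueness. For the indicator function the precedence of (C1) settles which case occurs. When
  (C1) is impossible, the multiplier cannot vanish, so \<open>w\<close> is the endpoint 1, and the
  quartic has a single nonnegative root: for \<open>w > 0\<close> it equates a function of \<open>\<mu>\<close> with 1 that is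
  identically 0 or strictly decreasing (\<open>quartic_root_unique\<close>).
\<close>

section \<open>Weighted Euclidean norms\<close>

definition weighted_norm :: "nat \<Rightarrow> real \<Rightarrow> real vec \<Rightarrow> real" where
  "weighted_norm m \<kappa> x = sqrt ((\<Sum>i<m. (x $ i)\<^sup>2) + \<kappa> * (x $ m)\<^sup>2)"

text \<open>
  Absorbing the weight into the vector makes the Cauchy-Schwarz inequality for \<^const>\<open>L2_set\<close>
  applicable.
\<close>

lemma weighted_norm_eq_L2_set:
  assumes "\<kappa> \<ge> 0"
  shows "weighted_norm m \<kappa> x = L2_set (\<lambda>i. (if i < m then 1 else sqrt \<kappa>) * x $ i) {..<Suc m}"
  using assms by (simp add: weighted_norm_def L2_set_def power_mult_distrib)

lemma weighted_norm_nonneg: "\<kappa> \<ge> 0 \<Longrightarrow> weighted_norm m \<kappa> x \<ge> 0"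
  by (auto simp: weighted_norm_def intro!: add_nonneg_nonneg sum_nonneg)

lemma weighted_norm_power2:
  "\<kappa> \<ge> 0 \<Longrightarrow> (weighted_norm m \<kappa> x)\<^sup>2 = (\<Sum>i<m. (x $ i)\<^sup>2) + \<kappa> * (x $ m)\<^sup>2"
  unfolding weighted_norm_def by (intro real_sqrt_pow2 add_nonneg_nonneg sum_nonneg) auto

lemma weighted_norm_zero: "weighted_norm m \<kappa> (0\<^sub>v (Suc m)) = 0"
  by (simp add: weighted_norm_def)

lemma weighted_norm_eq_0_imp:
  assumes "\<kappa> > 0" "x \<in> carrier_vec (Suc m)" "weighted_norm m \<kappa> x = 0"
  shows "x = 0\<^sub>v (Suc m)"
proof -
  have "(\<Sum>i<m. (x $ i)\<^sup>2) + \<kappa> * (x $ m)\<^sup>2 = 0"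
    using weighted_norm_power2[of \<kappa> m x] assms by simp
  moreover have "(\<Sum>i<m. (x $ i)\<^sup>2) \<ge> 0" "\<kappa> * (x $ m)\<^sup>2 \<ge> 0"
    using assms by (auto intro: sum_nonneg)
  ultimately have "(\<Sum>i<m. (x $ i)\<^sup>2) = 0" "\<kappa> * (x $ m)\<^sup>2 = 0" by linarith+
  then have "\<forall>i<Suc m. x $ i = 0"
    using assms(1) by (auto simp: sum_nonneg_eq_0_iff less_Suc_eq)
  then show ?thesis using assms(2) by (intro eq_vecI) auto
qed

lemma weighted_norm_smult:
  assumes "\<kappa> \<ge> 0" "x \<in> carrier_vec (Suc m)"
  shows "weighted_norm m \<kappa> (a \<cdot>\<^sub>v x) = \<bar>a\<bar> * weighted_norm m \<kappa> x"
proof -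
  have "(\<Sum>i<m. ((a \<cdot>\<^sub>v x) $ i)\<^sup>2) + \<kappa> * ((a \<cdot>\<^sub>v x) $ m)\<^sup>2
      = a\<^sup>2 * ((\<Sum>i<m. (x $ i)\<^sup>2) + \<kappa> * (x $ m)\<^sup>2)"
    using assms by (simp add: power_mult_distrib distrib_left sum_distrib_left)
  then show ?thesis by (simp add: weighted_norm_def real_sqrt_mult)
qed

lemma scalar_prod_Suc:
  fixes x y :: "real vec"
  assumes "y \<in> carrier_vec (Suc m)"
  shows "x \<bullet> y = (\<Sum>i<m. x $ i * y $ i) + x $ m * y $ m"
  using assms by (simp add: scalar_prod_def atLeast0LessThan)

text \<open>
  The weights \<open>\<kappa>\<close> and \<open>1 / \<kappa>\<close> are dual to each other: splitting the last product as
  \<open>(sqrt \<kappa> * x $ m) * (y $ m / sqrt \<kappa>)\<close> reduces this to the ordinary Cauchy-Schwarz inequality.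
\<close>

lemma scalar_prod_le_weighted_norms:
  assumes "\<kappa> > 0" "y \<in> carrier_vec (Suc m)"
  shows "x \<bullet> y \<le> weighted_norm m \<kappa> x * weighted_norm m (1 / \<kappa>) y"
proof -
  let ?f = "\<lambda>i. (if i < m then 1 else sqrt \<kappa>) * x $ i"
  let ?g = "\<lambda>i. (if i < m then 1 else sqrt (1 / \<kappa>)) * y $ i"
  have "x \<bullet> y = (\<Sum>i<Suc m. ?f i * ?g i)"
    using assms by (simp add: scalar_prod_Suc real_sqrt_divide)
  also have "\<dots> \<le> (\<Sum>i<Suc m. \<bar>?f i\<bar> * \<bar>?g i\<bar>)"
    by (intro sum_mono) (metis abs_ge_self abs_mult)
  also have "\<dots> \<le> L2_set ?f {..<Suc m} * L2_set ?g {..<Suc m}"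
    by (rule L2_set_mult_ineq)
  finally show ?thesis using assms by (simp add: weighted_norm_eq_L2_set)
qed

section \<open>Subgradients of a weighted norm\<close>

text \<open>
  The first equation is Euler's identity, obtained by testing the subgradient inequality at \<open>0\<close>
  and \<open>2 y\<close>. It turns the inequality into \<open>p \<bullet> v \<le> N v / \<tau>\<close> for all \<open>v\<close>, which is then
  tested at the vector that attains the dual norm of \<open>p\<close>.
\<close>

lemma subgradient_weighted_norm:
  fixes \<tau> \<kappa> :: real
  assumes "\<kappa> > 0" "\<tau> > 0" "y \<in> carrier_vec (Suc m)"
    and p: "p \<in> subdiff_vec (Suc m) (\<lambda>x. weighted_norm m \<kappa> x / \<tau>) y"
  shows "p \<bullet> y = weighted_norm m \<kappa> y / \<tau>" "\<tau> * weighted_norm m (1 / \<kappa>) p \<le> 1"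
proof -
  let ?N = "weighted_norm m \<kappa>"
  have pc: "p \<in> carrier_vec (Suc m)"
    and sub: "\<And>v. v \<in> carrier_vec (Suc m) \<Longrightarrow> ?N y / \<tau> + p \<bullet> (v - y) \<le> ?N v / \<tau>"
    using p by (auto simp: subdiff_vec_def)
  have dist: "p \<bullet> (v - y) = p \<bullet> v - p \<bullet> y" if "v \<in> carrier_vec (Suc m)" for v
    using that pc assms(3) by (simp add: scalar_prod_minus_distrib)
  have 1: "?N y / \<tau> \<le> p \<bullet> y"
    using sub[of "0\<^sub>v (Suc m)"] dist[of "0\<^sub>v (Suc m)"] pc by (simp add: weighted_norm_zero)
  have "?N (2 \<cdot>\<^sub>v y) = 2 * ?N y" "p \<bullet> (2 \<cdot>\<^sub>v y) = 2 * (p \<bullet> y)"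
    using assms pc by (simp_all add: weighted_norm_smult)
  then have "p \<bullet> y \<le> ?N y / \<tau>"
    using sub[of "2 \<cdot>\<^sub>v y"] dist[of "2 \<cdot>\<^sub>v y"] assms(3) by simp
  with 1 show py: "p \<bullet> y = ?N y / \<tau>" by simp
  (* v = (p_1, ..., p_m, p_{m+1} / \<kappa>) attains equality in p \<bullet> v <= N v * M, and N v = M *)
  define v where "v = vec (Suc m) (\<lambda>i. if i < m then p $ i else p $ m / \<kappa>)"
  have v: "v \<in> carrier_vec (Suc m)" by (simp add: v_def)
  let ?M = "weighted_norm m (1 / \<kappa>) p"
  have M2: "?M\<^sup>2 = (\<Sum>i<m. (p $ i)\<^sup>2) + (p $ m)\<^sup>2 / \<kappa>"
    using assms by (simp add: weighted_norm_power2)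
  have "p \<bullet> v = ?M\<^sup>2"
    using v unfolding M2 by (simp add: scalar_prod_Suc v_def power2_eq_square)
  moreover have "?N v = ?M"
    using assms(1) by (simp add: weighted_norm_def v_def power2_eq_square)
  ultimately have "?M\<^sup>2 \<le> ?M / \<tau>"
    using sub[OF v] dist[OF v] py by simp
  then have "?M * (\<tau> * ?M) \<le> ?M * 1"
    using assms(2) by (simp add: field_simps power2_eq_square)
  moreover have "?M \<ge> 0" using assms by (simp add: weighted_norm_nonneg)
  ultimately show "\<tau> * ?M \<le> 1"
    by (cases "?M = 0") auto
qed

text \<open>
  The vector \<open>\<tau>\<^sup>2 * w * p - (y\<^sub>1, \<dots>, y\<^sub>m, \<kappa> y\<^bsub>m+1\<^esub>)\<close>, measured in the dual norm, has square
  \<open>(\<tau> w)\<^sup>2 (\<tau> M)\<^sup>2 - (\<tau> w)\<^sup>2\<close>, where \<open>M\<close> is the dual norm of \<open>p\<close>; since \<open>\<tau> M \<le> 1\<close>, it vanishes.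
  Multiplying by \<open>w\<close> rather than dividing by it keeps the point \<open>y = 0\<close>, where the norm is not
  differentiable, from being an exception.
\<close>

lemma subgradient_weighted_norm_components:
  fixes \<tau> \<kappa> :: real
  assumes "\<kappa> > 0" "\<tau> > 0" "y \<in> carrier_vec (Suc m)"
    and p: "p \<in> subdiff_vec (Suc m) (\<lambda>x. weighted_norm m \<kappa> x / \<tau>) y"
    and w: "w = weighted_norm m \<kappa> y / \<tau>"
  shows "\<And>i. i < m \<Longrightarrow> \<tau>\<^sup>2 * w * p $ i = y $ i" "\<tau>\<^sup>2 * w * p $ m = \<kappa> * y $ m"
proof -
  let ?M = "weighted_norm m (1 / \<kappa>) p" and ?a = "\<tau>\<^sup>2 * w"
  note facts = subgradient_weighted_norm[OF assms(1-4)]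
  have y2: "(\<Sum>i<m. (y $ i)\<^sup>2) + \<kappa> * (y $ m)\<^sup>2 = (\<tau> * w)\<^sup>2"
    using weighted_norm_power2[of \<kappa> m y] assms by (simp add: field_simps)
  have M2: "?M\<^sup>2 = (\<Sum>i<m. (p $ i)\<^sup>2) + (p $ m)\<^sup>2 / \<kappa>"
    using assms by (simp add: weighted_norm_power2)
  have py: "(\<Sum>i<m. p $ i * y $ i) + p $ m * y $ m = w"
    using facts(1) scalar_prod_Suc[OF assms(3)] w by metis
  have "(\<tau> * ?M)\<^sup>2 \<le> 1"
    using facts(2) assms weighted_norm_nonneg[of "1 / \<kappa>" m p] by (simp add: abs_square_le_1)
  then have le: "(\<tau> * w)\<^sup>2 * (\<tau> * ?M)\<^sup>2 \<le> (\<tau> * w)\<^sup>2"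
    by (simp add: mult_left_le)
  have "(\<Sum>i<m. (?a * p $ i - y $ i)\<^sup>2) + (?a * p $ m - \<kappa> * y $ m)\<^sup>2 / \<kappa>
      = ?a\<^sup>2 * ((\<Sum>i<m. (p $ i)\<^sup>2) + (p $ m)\<^sup>2 / \<kappa>)
        - 2 * ?a * ((\<Sum>i<m. p $ i * y $ i) + p $ m * y $ m)
        + ((\<Sum>i<m. (y $ i)\<^sup>2) + \<kappa> * (y $ m)\<^sup>2)"
  proof -
    have "(\<Sum>i<m. (?a * p $ i - y $ i)\<^sup>2) = ?a\<^sup>2 * (\<Sum>i<m. (p $ i)\<^sup>2)
        - 2 * ?a * (\<Sum>i<m. p $ i * y $ i) + (\<Sum>i<m. (y $ i)\<^sup>2)"
      by (simp add: sum_distrib_left flip: sum_subtractf sum.distrib)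
        (simp add: power2_diff power_mult_distrib algebra_simps)
    moreover have "(?a * p $ m - \<kappa> * y $ m)\<^sup>2 / \<kappa>
        = ?a\<^sup>2 * ((p $ m)\<^sup>2 / \<kappa>) - 2 * ?a * (p $ m * y $ m) + \<kappa> * (y $ m)\<^sup>2"
      using assms(1) by (simp add: power2_eq_square field_simps)
    ultimately show ?thesis by (simp add: algebra_simps)
  qed
  also have "\<dots> = (\<tau> * w)\<^sup>2 * (\<tau> * ?M)\<^sup>2 - (\<tau> * w)\<^sup>2"
    unfolding M2[symmetric] py y2 by (simp add: power2_eq_square algebra_simps)
  also have "\<dots> \<le> 0" using le by simp
  finally have le0: "(\<Sum>i<m. (?a * p $ i - y $ i)\<^sup>2) + (?a * p $ m - \<kappa> * y $ m)\<^sup>2 / \<kappa> \<le> 0" .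
  moreover have "(\<Sum>i<m. (?a * p $ i - y $ i)\<^sup>2) \<ge> 0" "(?a * p $ m - \<kappa> * y $ m)\<^sup>2 / \<kappa> \<ge> 0"
    using assms(1) by (auto intro: sum_nonneg)
  ultimately have "(\<Sum>i<m. (?a * p $ i - y $ i)\<^sup>2) = 0" "(?a * p $ m - \<kappa> * y $ m)\<^sup>2 / \<kappa> = 0"
    by linarith+
  then show "\<And>i. i < m \<Longrightarrow> ?a * p $ i = y $ i" "?a * p $ m = \<kappa> * y $ m"
    using assms(1) by (auto simp: sum_nonneg_eq_0_iff)
qed

section \<open>The gauge function \<open>\<tau> * l2\<close>\<close>

lemma dual_norm_scaled_l2:
  fixes \<tau> :: real
  assumes "\<tau> > 0" "x \<in> carrier_vec n"
  shows "dual_norm n (\<lambda>v. \<tau> * l2 v) x = l2 x / \<tau>"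
  unfolding dual_norm_def
proof (rule cSup_eq_maximum)
  (* the normalized x is the maximizer; if x = 0, the quotient is 1 / 0 = 0, and the zero vector
     is a maximizer too *)
  define v where "v = (1 / (\<tau> * l2 x)) \<cdot>\<^sub>v x"
  have l2_power2: "(l2 x)\<^sup>2 = x \<bullet> x"
    by (simp add: l2_def L2_set_def sum_nonneg scalar_prod_def power2_eq_square atLeast0LessThan)
  have nonneg: "l2 x \<ge> 0" by (simp add: l2_def)
  have "l2 v = \<bar>1 / (\<tau> * l2 x)\<bar> * l2 x"
    by (simp add: v_def l2_def L2_set_def power_mult_distrib real_sqrt_mult
        flip: sum_distrib_left) (simp add: power_divide real_sqrt_divide flip: sum_divide_distrib)
  then have "\<tau> * l2 v \<le> 1" using assms nonneg by (cases "l2 x = 0") auto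
  moreover have "x \<bullet> v = (l2 x)\<^sup>2 / (\<tau> * l2 x)"
    using assms(2) by (simp add: v_def l2_power2)
  then have "x \<bullet> v = l2 x / \<tau>" by (simp add: power2_eq_square)
  ultimately show "l2 x / \<tau> \<in> {x \<bullet> v |v. v \<in> carrier_vec n \<and> \<tau> * l2 v \<le> 1}"
    using assms(2) by (auto simp: v_def intro!: exI[of _ v])
next
  fix u assume "u \<in> {x \<bullet> v |v. v \<in> carrier_vec n \<and> \<tau> * l2 v \<le> 1}"
  then obtain v where v: "u = x \<bullet> v" "v \<in> carrier_vec n" "\<tau> * l2 v \<le> 1" by auto
  have "u = (\<Sum>i<n. x $ i * v $ i)" using v by (simp add: scalar_prod_def atLeast0LessThan)
  also have "\<dots> \<le> (\<Sum>i<n. \<bar>x $ i\<bar> * \<bar>v $ i\<bar>)"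
    by (intro sum_mono) (metis abs_ge_self abs_mult)
  also have "\<dots> \<le> l2 x * l2 v"
    using L2_set_mult_ineq[of "\<lambda>i. x $ i" "\<lambda>i. v $ i" "{..<n}"] assms v by (simp add: l2_def)
  also have "\<dots> \<le> l2 x * (1 / \<tau>)"
    using v assms by (intro mult_left_mono) (auto simp: l2_def field_simps)
  finally show "u \<le> l2 x / \<tau>" by simp
qed

text \<open>
  The \<open>t\<close> copies of the scaled last entry contribute \<open>t * a\<^sup>2\<close> times its square. With
  \<open>a = 1 / sqrt (t + s)\<close> and \<open>a = sqrt (t + s) / t\<close> the resulting weights are reciprocal, so that
  the two vectors built from \<open>x\<close> have dual norms.
\<close>

lemma l2_repeated_entry:
  assumes "t \<le> r" "r \<le> n"
  shows "l2 (vec n (\<lambda>i. if i < r - t then x $ i else if i < r then a * x $ (r - t) else 0))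
    = weighted_norm (r - t) (real t * a\<^sup>2) x"
proof -
  define h where
    "h i = (if i < r - t then x $ i else if i < r then a * x $ (r - t) else 0)\<^sup>2" for i
  have "(\<Sum>i<n. h i) = (\<Sum>i=0..<r - t. h i) + (\<Sum>i=r - t..<r. h i) + (\<Sum>i=r..<n. h i)"
    using assms by (simp add: sum.atLeastLessThan_concat lessThan_atLeast0)
  also have "(\<Sum>i=r..<n. h i) = 0"
    by (rule sum.neutral) (auto simp: h_def)
  also have "(\<Sum>i=0..<r - t. h i) + (\<Sum>i=r - t..<r. h i) + 0
      = (\<Sum>i<r - t. (x $ i)\<^sup>2) + real t * (a * x $ (r - t))\<^sup>2"
    using assms by (simp add: h_def lessThan_atLeast0)
  finally show ?thesis
    by (simp add: l2_def L2_set_def weighted_norm_def power_mult_distrib mult.assoc h_def)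
qed

lemma dual_rst_scaled_l2:
  fixes \<tau> :: real
  assumes "t \<le> r" "r \<le> n" "\<tau> > 0"
  shows "dual_rst n r s t (\<lambda>x. \<tau> * l2 x)
    = (\<lambda>x. weighted_norm (r - t) (real t / real (s + t)) x / \<tau>)"
proof
  fix x
  show "dual_rst n r s t (\<lambda>x. \<tau> * l2 x) x
      = weighted_norm (r - t) (real t / real (s + t)) x / \<tau>"
    using l2_repeated_entry[OF assms(1,2), where a = "1 / sqrt (real (t + s))" and x = x] assms(3)
    by (simp add: dual_rst_def dual_norm_scaled_l2 power_divide add.commute cong: if_cong)
qed

lemma primal_rst_scaled_l2:
  assumes "1 \<le> t" "t \<le> r" "r \<le> n"
  shows "primal_rst n r s t (\<lambda>x. \<tau> * l2 x) x
    = \<tau> * weighted_norm (r - t) (real (s + t) / real t) x"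
proof -
  have "real t * (sqrt (real (t + s)) / real t)\<^sup>2 = real (s + t) / real t"
    using assms(1) by (simp add: power_divide power2_eq_square[of "real t"])
  then show ?thesis
    unfolding primal_rst_def l2_repeated_entry[OF assms(2,3)] by simp
qed

section \<open>The two functions \<open>f\<close>\<close>

lemma subdiff_shifted_square: "subdiff (shifted_square zv) w = {w + zv}"
proof -
  have "\<mu> = w + zv" if "\<mu> \<in> subdiff (shifted_square zv) w" for \<mu>
  proof -
    have "1 / 2 * (w + zv)\<^sup>2 + \<mu> * (v - w) \<le> 1 / 2 * (v + zv)\<^sup>2" for v
      using that by (simp add: subdiff_def shifted_square_def)
    (* the convex conjugate: v = \<mu> - zv minimizes f v - \<mu> v *)
    from this[of "\<mu> - zv"] have "(\<mu> - (w + zv))\<^sup>2 \<le> 0"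
      by (simp add: power2_eq_square algebra_simps)
    then show ?thesis by simp
  qed
  moreover have "1 / 2 * (w + zv)\<^sup>2 + (w + zv) * (v - w) \<le> 1 / 2 * (v + zv)\<^sup>2" for v
  proof -
    have "(v - w)\<^sup>2 \<ge> 0" by simp
    then show ?thesis by (simp add: power2_eq_square algebra_simps)
  qed
  ultimately show ?thesis by (auto simp: subdiff_def shifted_square_def)
qed

lemma is_argmin_shifted_square: "is_argmin (shifted_square zv) w \<longleftrightarrow> w = - zv"
proof -
  have "is_arg_min (shifted_square zv) (\<lambda>_. True) v \<longleftrightarrow> v = - zv" for v
  proof
    assume "is_arg_min (shifted_square zv) (\<lambda>_. True) v"
    then have "\<not> shifted_square zv (- zv) < shifted_square zv v"
      by (auto simp: is_arg_min_def)
    then show "v = - zv" by (auto simp: shifted_square_def not_less)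
  qed (auto simp: is_arg_min_def shifted_square_def not_less)
  then show ?thesis by (auto simp: is_argmin_def)
qed

lemma is_argmin_convex_indicator: "is_argmin (convex_indicator {0..1}) w \<longleftrightarrow> w = 1"
proof -
  have "is_arg_min (convex_indicator {0..1}) (\<lambda>_. True) v \<longleftrightarrow> v \<in> {0..1}" for v
  proof
    assume "is_arg_min (convex_indicator {0..1}) (\<lambda>_. True) v"
    then have "\<not> convex_indicator {0..1} 0 < convex_indicator {0..1} v"
      by (auto simp: is_arg_min_def)
    then show "v \<in> {0..1}" by (auto simp: convex_indicator_def split: if_splits)
  qed (auto simp: is_arg_min_def convex_indicator_def)
  then have iff: "is_argmin (convex_indicator {0..1}) w \<longleftrightarrow> w \<in> {0..1} \<and> (\<forall>v \<in> {0..1}. v \<le> w)"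
    by (simp only: is_argmin_def Ball_def)
  show ?thesis
  proof
    assume "is_argmin (convex_indicator {0..1}) w"
    then have "w \<in> {0..1}" "\<forall>v \<in> {0..1}. v \<le> w" using iff by blast+
    moreover have "(1::real) \<in> {0..1}" by simp
    ultimately have "w \<le> 1" "1 \<le> w" by auto
    then show "w = 1" by simp
  qed (use iff in simp)
qed

text \<open>
  The last conclusion is the subgradient inequality at the right endpoint: a positive multiplier
  occurs only at \<open>w = 1\<close>, and a multiplier at \<open>w = 0\<close> is nonpositive.
\<close>

lemma subdiff_convex_indicator:
  assumes "\<mu> \<in> subdiff (convex_indicator {0..1}) w"
  shows "0 \<le> w" "w \<le> 1" "\<mu> * (1 - w) \<le> 0"
proof -
  have sub: "convex_indicator {0..1} w + ereal (\<mu> * (v - w)) \<le> convex_indicator {0..1} v" for v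
    using assms by (simp add: subdiff_def)
  from sub[of 0] have "w \<in> {0..1}"
    by (auto simp: convex_indicator_def split: if_splits)
  with sub[of 1] show "0 \<le> w" "w \<le> 1" "\<mu> * (1 - w) \<le> 0"
    by (auto simp: convex_indicator_def)
qed

section \<open>Solutions of (C3) and the quartic equation\<close>

lemma multiplier_C3_scaled_l2:
  fixes \<tau> :: real
  assumes "t \<le> r" "r \<le> n" "\<tau> > 0"
  shows "multiplier_C3 n r s t (\<lambda>x. \<tau> * l2 x) f 1 z y w \<mu> \<longleftrightarrow>
    \<mu> \<in> subdiff f w \<and> \<mu> \<ge> 0 \<and>
    (\<exists>p \<in> subdiff_vec (Suc (r - t))
        (\<lambda>x. weighted_norm (r - t) (real t / real (s + t)) x / \<tau>) y. z - y = \<mu> \<cdot>\<^sub>v p) \<and>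
    w = weighted_norm (r - t) (real t / real (s + t)) y / \<tau>"
  using dual_rst_scaled_l2[OF assms] by (auto simp: multiplier_C3_def)

text \<open>
  Dividing the quartic by the two squares puts it into the form of a secular equation, whose
  left-hand side is visibly monotone in \<open>\<mu>\<close>.
\<close>

lemma quartic_eq_0_iff:
  assumes "1 \<le> t" "\<tau> > 0" "w > 0" "\<mu> \<ge> 0"
  shows "quartic \<tau> s t c1 c2 w \<mu> = 0 \<longleftrightarrow>
    c1 / (w * \<tau> + \<mu> / \<tau>)\<^sup>2
      + real t * c2\<^sup>2 / (real (t + s) * \<tau> * w + \<mu> / \<tau> * real t)\<^sup>2 = 1"
proof -
  define A where "A = w * \<tau> + \<mu> / \<tau>"
  define B where "B = real (t + s) * \<tau> * w + \<mu> / \<tau> * real t"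
  have "A > 0" "B > 0" using assms by (auto simp: A_def B_def intro!: add_pos_nonneg)
  then have "c1 / A\<^sup>2 + real t * c2\<^sup>2 / B\<^sup>2 = 1 \<longleftrightarrow> (A\<^sup>2 - c1) * B\<^sup>2 - real t * c2\<^sup>2 * A\<^sup>2 = 0"
    by (simp add: field_simps)
  then show ?thesis unfolding quartic_def A_def B_def by blast
qed

text \<open>
  Both denominators of the secular equation increase strictly with \<open>\<mu>\<close>. Two roots would therefore
  need both numerators to vanish, but then the sum is 0 instead of 1.
\<close>

lemma quartic_root_unique:
  assumes "1 \<le> t" "\<tau> > 0" "w > 0" "c1 \<ge> 0"
    and "\<mu> \<ge> 0" "quartic \<tau> s t c1 c2 w \<mu> = 0" "\<mu>' \<ge> 0" "quartic \<tau> s t c1 c2 w \<mu>' = 0"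
  shows "\<mu>' = \<mu>"
proof -
  have False if lt: "a < b" and a: "a \<ge> 0" "quartic \<tau> s t c1 c2 w a = 0"
    and b: "b \<ge> 0" "quartic \<tau> s t c1 c2 w b = 0" for a b
  proof -
    define A where "A \<mu> = w * \<tau> + \<mu> / \<tau>" for \<mu>
    define B where "B \<mu> = real (t + s) * \<tau> * w + \<mu> / \<tau> * real t" for \<mu>
    have pos: "A a > 0" "B a > 0" using assms a by (auto simp: A_def B_def intro!: add_pos_nonneg)
    have less: "A a < A b" "B a < B b"
      using lt assms by (auto simp: A_def B_def divide_strict_right_mono)
    have dec: "c / y\<^sup>2 \<le> c / x\<^sup>2 \<and> (c / y\<^sup>2 = c / x\<^sup>2 \<longrightarrow> c = 0)"
      if "0 < x" "x < y" "c \<ge> 0" for c x y :: real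
    proof -
      have "x\<^sup>2 < y\<^sup>2" using that by (simp add: power_strict_mono)
      then have "c / y\<^sup>2 < c / x\<^sup>2" if "c > 0"
        using that \<open>0 < x\<close> \<open>x < y\<close> by (intro divide_strict_left_mono mult_pos_pos) auto
      with \<open>c \<ge> 0\<close> show ?thesis by (cases "c = 0") (auto simp: less_le)
    qed
    have eq: "c1 / (A a)\<^sup>2 + real t * c2\<^sup>2 / (B a)\<^sup>2 = 1"
      using a quartic_eq_0_iff[OF assms(1-3)] unfolding A_def B_def by blast
    have "c1 / (A b)\<^sup>2 + real t * c2\<^sup>2 / (B b)\<^sup>2 = 1"
      using b quartic_eq_0_iff[OF assms(1-3)] unfolding A_def B_def by blast
    moreover have decA: "c1 / (A b)\<^sup>2 \<le> c1 / (A a)\<^sup>2" "c1 / (A b)\<^sup>2 = c1 / (A a)\<^sup>2 \<longrightarrow> c1 = 0"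
      using dec[OF pos(1) less(1) assms(4)] by blast+
    moreover have decB: "real t * c2\<^sup>2 / (B b)\<^sup>2 \<le> real t * c2\<^sup>2 / (B a)\<^sup>2"
      "real t * c2\<^sup>2 / (B b)\<^sup>2 = real t * c2\<^sup>2 / (B a)\<^sup>2 \<longrightarrow> real t * c2\<^sup>2 = 0"
      using dec[OF pos(2) less(2), of "real t * c2\<^sup>2"] by simp_all
    ultimately have "c1 / (A b)\<^sup>2 = c1 / (A a)\<^sup>2"
      "real t * c2\<^sup>2 / (B b)\<^sup>2 = real t * c2\<^sup>2 / (B a)\<^sup>2"
      using eq by linarith+
    then have "c1 = 0" "real t * c2\<^sup>2 = 0" using decA(2) decB(2) by blast+
    with eq show False by simp
  qed
  then show ?thesis using assms(5-8) by (meson linorder_cases)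
qed

text \<open>
  The function \<open>f\<close> enters (C3) only through the condition on \<open>\<mu>\<close>, so these formulas hold for any
  \<open>f\<close>. Multiplying \<open>z = y + \<mu> p\<close> by the gradient formula for \<open>p\<close> shows that \<open>z\<close> is a componentwise
  multiple of \<open>y\<close>. The quartic is the equation \<open>D y = w\<close>, squared, in terms of \<open>z\<close>.
\<close>

lemma multiplier_C3_solution:
  fixes \<tau> :: real
  assumes "1 \<le> t" "t \<le> r" "r \<le> n" "\<tau> > 0"
    and z: "z \<in> carrier_vec (r - t + 1)" and y: "y \<in> carrier_vec (r - t + 1)"
    and "w > 0"
    and C3: "multiplier_C3 n r s t (\<lambda>x. \<tau> * l2 x) f 1 z y w \<mu>"
  shows "\<And>i. i < r - t \<Longrightarrow> y $ i = z $ i / (1 + \<mu> / (\<tau>\<^sup>2 * w))"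
    and "y $ (r - t) = z $ (r - t) / (1 + \<mu> * real t / (\<tau>\<^sup>2 * w * real (s + t)))"
    and "quartic \<tau> s t (\<Sum>i<r - t. (z $ i)\<^sup>2) (sqrt (real (t + s)) * z $ (r - t)) w \<mu> = 0"
proof -
  define m where "m = r - t"
  define \<kappa> where "\<kappa> = real t / real (s + t)"
  have \<kappa>: "\<kappa> > 0" using assms by (simp add: \<kappa>_def)
  have zc: "z \<in> carrier_vec (Suc m)" and yc: "y \<in> carrier_vec (Suc m)"
    using z y by (auto simp: m_def)
  obtain p where p: "p \<in> subdiff_vec (Suc m) (\<lambda>x. weighted_norm m \<kappa> x / \<tau>) y"
    and eq: "z - y = \<mu> \<cdot>\<^sub>v p" and \<mu>: "\<mu> \<ge> 0" and w: "w = weighted_norm m \<kappa> y / \<tau>"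
    using C3 multiplier_C3_scaled_l2[OF assms(2-4)] by (auto simp: m_def \<kappa>_def)
  have pc: "p \<in> carrier_vec (Suc m)" using p by (simp add: subdiff_vec_def)
  have zi: "z $ i = y $ i + \<mu> * p $ i" if "i < Suc m" for i
  proof -
    have "(z - y) $ i = \<mu> * p $ i" unfolding eq using that pc by simp
    then show ?thesis using that zc yc by simp
  qed
  note comp = subgradient_weighted_norm_components[OF \<kappa> assms(4) yc p w]
  have \<tau>w: "\<tau>\<^sup>2 * w > 0" using assms by simp
  have pos: "1 + \<mu> / (\<tau>\<^sup>2 * w) > 0" "1 + \<mu> * \<kappa> / (\<tau>\<^sup>2 * w) > 0"
    using \<mu> \<tau>w \<kappa> by (auto intro!: add_pos_nonneg)
  have yi: "y $ i = z $ i / (1 + \<mu> / (\<tau>\<^sup>2 * w))" if "i < m" for i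
  proof -
    have "p $ i = y $ i / (\<tau>\<^sup>2 * w)" using comp(1)[OF that] \<tau>w
      by (metis less_irrefl nonzero_mult_div_cancel_left)
    then have "z $ i = y $ i * (1 + \<mu> / (\<tau>\<^sup>2 * w))"
      using zi[of i] that by (simp add: algebra_simps)
    then show ?thesis using pos by simp
  qed
  then show "\<And>i. i < r - t \<Longrightarrow> y $ i = z $ i / (1 + \<mu> / (\<tau>\<^sup>2 * w))" by (simp add: m_def)
  have "p $ m = \<kappa> * y $ m / (\<tau>\<^sup>2 * w)" using comp(2) \<tau>w
    by (metis less_irrefl nonzero_mult_div_cancel_left)
  then have "z $ m = y $ m * (1 + \<mu> * \<kappa> / (\<tau>\<^sup>2 * w))"
    using zi[of m] by (simp add: algebra_simps)
  then have ym: "y $ m = z $ m / (1 + \<mu> * \<kappa> / (\<tau>\<^sup>2 * w))" using pos by simp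
  then show "y $ (r - t) = z $ (r - t) / (1 + \<mu> * real t / (\<tau>\<^sup>2 * w * real (s + t)))"
    by (simp add: m_def \<kappa>_def)
  (* A and B are the factors of the quartic; the two shrinkage denominators are A / (\<tau> w) and
     B / ((s + t) \<tau> w) *)
  define A where "A = w * \<tau> + \<mu> / \<tau>"
  define B where "B = real (t + s) * \<tau> * w + \<mu> / \<tau> * real t"
  define c1 where "c1 = (\<Sum>i<m. (z $ i)\<^sup>2)"
  define c2 where "c2 = sqrt (real (t + s)) * z $ m"
  have "1 + \<mu> / (\<tau>\<^sup>2 * w) = A / (\<tau> * w)"
    using assms by (simp add: A_def field_simps power2_eq_square)
  then have "(y $ i)\<^sup>2 = (\<tau> * w)\<^sup>2 * ((z $ i)\<^sup>2 / A\<^sup>2)" if "i < m" for i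
    using yi[OF that] by (simp add: power_divide power_mult_distrib)
  then have "(\<Sum>i<m. (y $ i)\<^sup>2) = (\<tau> * w)\<^sup>2 * (c1 / A\<^sup>2)"
    by (simp add: c1_def sum_distrib_left sum_divide_distrib)
  moreover have "\<kappa> * (y $ m)\<^sup>2 = (\<tau> * w)\<^sup>2 * (real t * c2\<^sup>2 / B\<^sup>2)"
  proof -
    define q where "q = real (s + t)"
    have q: "q > 0" "real (t + s) = q" using assms by (simp_all add: q_def)
    have "1 + \<mu> * \<kappa> / (\<tau>\<^sup>2 * w) = B / (q * (\<tau> * w))"
      using assms q unfolding B_def \<kappa>_def q_def[symmetric]
      by (simp add: field_simps power2_eq_square)
    then have "y $ m = z $ m * (q * (\<tau> * w)) / B" using ym by simp
    then show ?thesis using q unfolding \<kappa>_def c2_def q_def[symmetric]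
      by (simp add: power_divide power_mult_distrib power2_eq_square)
  qed
  moreover have "(\<Sum>i<m. (y $ i)\<^sup>2) + \<kappa> * (y $ m)\<^sup>2 = (\<tau> * w)\<^sup>2"
    using weighted_norm_power2[of \<kappa> m y] w \<kappa> assms(4) by simp
  ultimately have "(\<tau> * w)\<^sup>2 * (c1 / A\<^sup>2 + real t * c2\<^sup>2 / B\<^sup>2) = (\<tau> * w)\<^sup>2"
    by (simp only: distrib_left)
  then have "c1 / A\<^sup>2 + real t * c2\<^sup>2 / B\<^sup>2 = 1" using assms by simp
  then show "quartic \<tau> s t (\<Sum>i<r - t. (z $ i)\<^sup>2) (sqrt (real (t + s)) * z $ (r - t)) w \<mu> = 0"
    using quartic_eq_0_iff[OF assms(1,4) \<open>w > 0\<close> \<mu>]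
    unfolding A_def B_def c1_def c2_def m_def by blast
qed

section \<open>Uniqueness for the quadratic function\<close>

text \<open>
  For convex \<open>D\<close>, this is the first-order optimality condition for minimizing \<open>(w + zv)\<^sup>2 / 2 + |y - z|\<^sup>2 / 2\<close> over
  the epigraph of \<open>D\<close>, that is, the characterization of \<open>(y, w)\<close> as the projection of \<open>(z, - zv)\<close>.
\<close>

definition variational_solution ::
    "nat \<Rightarrow> (real vec \<Rightarrow> real) \<Rightarrow> real \<Rightarrow> real vec \<Rightarrow> real vec \<Rightarrow> real \<Rightarrow> bool" where
  "variational_solution d D zv z y w \<longleftrightarrow> y \<in> carrier_vec d \<and> D y \<le> w \<and>
     (\<forall>x \<in> carrier_vec d. \<forall>v \<ge> D x. 0 \<le> (w + zv) * (v - w) + (y - z) \<bullet> (x - y))"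

text \<open>
  Testing each of the two inequalities at the other solution and adding them bounds the squared distance of
  the solutions by 0. This is the strong monotonicity of the gradient.
\<close>

lemma variational_solution_unique:
  assumes "z \<in> carrier_vec d"
    and 1: "variational_solution d D zv z y w" and 2: "variational_solution d D zv z y' w'"
  shows "y' = y" "w' = w"
proof -
  have y: "y \<in> carrier_vec d" "y' \<in> carrier_vec d"
    using 1 2 by (auto simp: variational_solution_def)
  have "0 \<le> (w + zv) * (w' - w) + (y - z) \<bullet> (y' - y)"
    "0 \<le> (w' + zv) * (w - w') + (y' - z) \<bullet> (y - y')"
    using 1 2 unfolding variational_solution_def by blast+
  moreover have "(y - z) \<bullet> (y' - y) + (y' - z) \<bullet> (y - y') = - (\<Sum>i<d. (y $ i - y' $ i)\<^sup>2)"
    using y assms(1)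
    by (simp add: scalar_prod_def atLeast0LessThan flip: sum.distrib sum_negf)
      (intro sum.cong; simp add: power2_eq_square algebra_simps)
  moreover have "(w + zv) * (w' - w) + (w' + zv) * (w - w') = - (w - w')\<^sup>2"
    by (simp add: power2_eq_square algebra_simps)
  ultimately have "(w - w')\<^sup>2 + (\<Sum>i<d. (y $ i - y' $ i)\<^sup>2) \<le> 0" by linarith
  moreover have "(\<Sum>i<d. (y $ i - y' $ i)\<^sup>2) \<ge> 0" "(w - w')\<^sup>2 \<ge> 0" by (auto intro: sum_nonneg)
  ultimately have "(\<Sum>i<d. (y $ i - y' $ i)\<^sup>2) = 0" "(w - w')\<^sup>2 = 0" by linarith+
  then show "y' = y" "w' = w" using y by (auto simp: sum_nonneg_eq_0_iff intro!: eq_vecI)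
qed

text \<open>
  In (C1) the gradient of the objective vanishes. In (C2) it is \<open>(- z, zv)\<close>, and \<open>x \<bullet> z \<le> D x * zv\<close>
  by duality of the two weighted norms. In (C3) it is \<open>\<mu>\<close> times the vector \<open>(- p, 1)\<close>, which has a nonnegative
  scalar product with every direction into the epigraph by the subgradient inequality.
\<close>

lemma cases_shifted_square_imp_variational_solution:
  fixes \<tau> :: real
  assumes "1 \<le> t" "t \<le> r" "r \<le> n" "\<tau> > 0"
    and z: "z \<in> carrier_vec (r - t + 1)" and y: "y \<in> carrier_vec (r - t + 1)"
    and cases: "case_C1 n r s t (\<lambda>x. \<tau> * l2 x) (shifted_square zv) z y w
      \<or> case_C2 n r s t (\<lambda>x. \<tau> * l2 x) (shifted_square zv) 1 z y w
      \<or> case_C3 n r s t (\<lambda>x. \<tau> * l2 x) (shifted_square zv) 1 z y w"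
  shows "variational_solution (r - t + 1) (dual_rst n r s t (\<lambda>x. \<tau> * l2 x)) zv z y w"
proof -
  define m where "m = r - t"
  define \<kappa> where "\<kappa> = real t / real (s + t)"
  have \<kappa>: "\<kappa> > 0" "1 / \<kappa> = real (s + t) / real t" using assms by (simp_all add: \<kappa>_def)
  define D where "D x = weighted_norm m \<kappa> x / \<tau>" for x
  have D: "dual_rst n r s t (\<lambda>x. \<tau> * l2 x) = D"
    using dual_rst_scaled_l2[OF assms(2-4)] by (simp add: D_def m_def \<kappa>_def fun_eq_iff)
  have P: "primal_rst n r s t (\<lambda>x. \<tau> * l2 x) x = \<tau> * weighted_norm m (1 / \<kappa>) x" for x
    using primal_rst_scaled_l2[OF assms(1-3)] \<kappa>(2) by (simp add: m_def)
  have D_nonneg: "D x \<ge> 0" for x using \<kappa> assms(4) by (simp add: D_def weighted_norm_nonneg)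
  have zc: "z \<in> carrier_vec (Suc m)" and yc: "y \<in> carrier_vec (Suc m)"
    using z y by (auto simp: m_def)
  have "D y \<le> w \<and> 0 \<le> (w + zv) * (v - w) + (y - z) \<bullet> (x - y)"
    if x: "x \<in> carrier_vec (Suc m)" and v: "D x \<le> v" for x v
    using cases
  proof (elim disjE)
    assume "case_C1 n r s t (\<lambda>x. \<tau> * l2 x) (shifted_square zv) z y w"
    then have "y = z" "w = - zv" "D y \<le> w"
      by (auto simp: case_C1_def D is_argmin_shifted_square)
    moreover have "(z - z) \<bullet> (x - z) = 0" using x zc by (simp add: scalar_prod_def)
    ultimately show ?thesis by simp
  next
    assume "case_C2 n r s t (\<lambda>x. \<tau> * l2 x) (shifted_square zv) 1 z y w"
    then have C2: "y = 0\<^sub>v (Suc m)" "w = 0" "\<tau> * weighted_norm m (1 / \<kappa>) z \<le> zv"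
      by (auto simp: case_C2_def P subdiff_shifted_square m_def)
    have "x \<bullet> z \<le> weighted_norm m \<kappa> x * weighted_norm m (1 / \<kappa>) z"
      by (rule scalar_prod_le_weighted_norms[OF \<kappa>(1) zc])
    also have "\<dots> = D x * (\<tau> * weighted_norm m (1 / \<kappa>) z)" using assms(4) by (simp add: D_def)
    also have "\<dots> \<le> v * zv"
      using C2(3) v D_nonneg[of x] \<kappa>(1) assms(4)
      by (intro mult_mono) (auto simp: weighted_norm_nonneg)
    finally have "x \<bullet> z \<le> v * zv" .
    moreover have "(0\<^sub>v (Suc m) - z) \<bullet> (x - 0\<^sub>v (Suc m)) = - (x \<bullet> z)"
      using x zc by (simp add: scalar_prod_def sum_negf mult.commute)
    ultimately show ?thesis using C2 by (simp add: D_def weighted_norm_zero mult.commute)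
  next
    assume "case_C3 n r s t (\<lambda>x. \<tau> * l2 x) (shifted_square zv) 1 z y w"
    then obtain \<mu> p where p: "p \<in> subdiff_vec (Suc m) D y" and "z - y = \<mu> \<cdot>\<^sub>v p"
      and \<mu>: "\<mu> \<ge> 0" "\<mu> = w + zv" and w: "w = D y"
      using multiplier_C3_scaled_l2[OF assms(2-4)]
      by (auto simp: case_C3_def m_def \<kappa>_def D_def[abs_def] subdiff_shifted_square)
    have pc: "p \<in> carrier_vec (Suc m)" and "D y + p \<bullet> (x - y) \<le> D x"
      using p x by (auto simp: subdiff_vec_def)
    then have "\<mu> * (p \<bullet> (x - y)) \<le> \<mu> * (v - w)"
      using v w \<mu>(1) by (intro mult_left_mono) auto
    moreover have "(y - z) \<bullet> (x - y) = - ((z - y) \<bullet> (x - y))"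
      using x yc zc by (simp add: scalar_prod_def del: sum.op_ivl_Suc flip: sum_negf)
        (intro sum.cong; simp add: algebra_simps)
    then have "(y - z) \<bullet> (x - y) = - (\<mu> * (p \<bullet> (x - y)))"
      unfolding \<open>z - y = \<mu> \<cdot>\<^sub>v p\<close> using pc x yc by simp
    ultimately show ?thesis using w \<mu>(2) by simp
  qed
  from this this[OF yc order.refl] show ?thesis
    unfolding D variational_solution_def m_def[symmetric] by (simp add: yc)
qed

section \<open>The solutions for both functions\<close>

theorem proposition3:
  fixes n r s t :: nat and \<tau> \<gamma> zv w c1 c2 :: real
    and g :: "real vec \<Rightarrow> real" and z y :: "real vec"
  assumes "1 \<le> t" "t \<le> r" "r \<le> n" "s \<le> n - r"
    and "\<tau> > 0" "\<gamma> = 1"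
    and "g = (\<lambda>x. \<tau> * l2 x)"
    and "z \<in> carrier_vec (r - t + 1)"
    and "\<forall>i < r - t + 1. z $ i \<ge> 0"
    and "\<forall>i j. i \<le> j \<and> j < r - t + 1 \<longrightarrow> z $ j \<le> z $ i"
    and "c1 = (\<Sum>i<r - t. (z $ i)\<^sup>2)"
    and "c2 = sqrt (real (t + s)) * z $ (r - t)"
    and "y \<in> carrier_vec (r - t + 1)"
  shows
    "(case_C1 n r s t g (shifted_square zv) z y w
        \<or> case_C2 n r s t g (shifted_square zv) \<gamma> z y w
        \<or> case_C3 n r s t g (shifted_square zv) \<gamma> z y w
      \<longrightarrow>
        (case_C1 n r s t g (shifted_square zv) z y w \<longleftrightarrow> (y, w) = (z, - zv))
      \<and> ((y, w) = (z, - zv) \<longleftrightarrow>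
           sqrt ((\<Sum>i<r - t. (z $ i)\<^sup>2) + real t / real (s + t) * (z $ (r - t))\<^sup>2) \<le> - \<tau> * zv)
      \<and> (case_C2 n r s t g (shifted_square zv) \<gamma> z y w \<longleftrightarrow> (y, w) = (0\<^sub>v (r - t + 1), 0))
      \<and> ((y, w) = (0\<^sub>v (r - t + 1), 0) \<longleftrightarrow>
           sqrt ((\<Sum>i<r - t. (z $ i)\<^sup>2) + real (s + t) / real t * (z $ (r - t))\<^sup>2) \<le> zv / \<tau>)
      \<and> (\<not> sqrt ((\<Sum>i<r - t. (z $ i)\<^sup>2) + real t / real (s + t) * (z $ (r - t))\<^sup>2) \<le> - \<tau> * zv
          \<and> \<not> sqrt ((\<Sum>i<r - t. (z $ i)\<^sup>2) + real (s + t) / real t * (z $ (r - t))\<^sup>2) \<le> zv / \<tau>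
          \<longrightarrow> (\<exists>\<mu>\<ge>0.
                multiplier_C3 n r s t g (shifted_square zv) \<gamma> z y w \<mu>
              \<and> (\<forall>y' w' \<mu>'. y' \<in> carrier_vec (r - t + 1) \<and>
                   multiplier_C3 n r s t g (shifted_square zv) \<gamma> z y' w' \<mu>' \<longrightarrow> \<mu>' = \<mu>)
              \<and> w = \<mu> - zv \<and> w > 0
              \<and> (\<forall>i < r - t. y $ i = z $ i / (1 + \<mu> / (\<tau>\<^sup>2 * w)))
              \<and> y $ (r - t) = z $ (r - t) / (1 + \<mu> * real t / (\<tau>\<^sup>2 * w * real (s + t)))
              \<and> quartic \<tau> s t c1 c2 w \<mu> = 0)))
     \<and>
     (cases_C1_first n r s t g (convex_indicator {0..\<gamma>}) \<gamma> z y w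
      \<longrightarrow>
        (case_C1 n r s t g (convex_indicator {0..\<gamma>}) z y w
            \<or> case_C2 n r s t g (convex_indicator {0..\<gamma>}) \<gamma> z y w
          \<longleftrightarrow> (y, w) = (z, 1))
      \<and> ((y, w) = (z, 1) \<longleftrightarrow>
           sqrt ((\<Sum>i<r - t. (z $ i)\<^sup>2) + real t / real (s + t) * (z $ (r - t))\<^sup>2) \<le> \<tau>)
      \<and> (\<not> sqrt ((\<Sum>i<r - t. (z $ i)\<^sup>2) + real t / real (s + t) * (z $ (r - t))\<^sup>2) \<le> \<tau>
          \<longrightarrow> w = 1
            \<and> (\<exists>\<mu>\<ge>0.
                multiplier_C3 n r s t g (convex_indicator {0..\<gamma>}) \<gamma> z y w \<mu>
              \<and> (\<forall>i < r - t. y $ i = z $ i / (1 + \<mu> / \<tau>\<^sup>2))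
              \<and> y $ (r - t) = z $ (r - t) / (1 + \<mu> * real t / (\<tau>\<^sup>2 * real (s + t)))
              \<and> (\<forall>\<mu>'\<ge>0. quartic \<tau> s t c1 c2 1 \<mu>' = 0 \<longleftrightarrow> \<mu>' = \<mu>))))"
proof -
  have t: "1 \<le> t" "t \<le> r" "r \<le> n" and \<tau>: "\<tau> > 0"
    and zc: "z \<in> carrier_vec (r - t + 1)" and yc: "y \<in> carrier_vec (r - t + 1)"
    and c1: "(\<Sum>i<r - t. (z $ i)\<^sup>2) = c1" and c2: "sqrt (real (t + s)) * z $ (r - t) = c2"
    using assms by auto
  note [simp] = \<open>\<gamma> = 1\<close> \<open>g = (\<lambda>x. \<tau> * l2 x)\<close>
  define D where "D = dual_rst n r s t (\<lambda>x. \<tau> * l2 x)"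
  define \<kappa> where "\<kappa> = real t / real (s + t)"
  let ?N = "sqrt ((\<Sum>i<r - t. (z $ i)\<^sup>2) + real t / real (s + t) * (z $ (r - t))\<^sup>2)"
  let ?N' = "sqrt ((\<Sum>i<r - t. (z $ i)\<^sup>2) + real (s + t) / real t * (z $ (r - t))\<^sup>2)"
  let ?C1 = "case_C1 n r s t g (shifted_square zv) z"
  let ?C2 = "case_C2 n r s t g (shifted_square zv) \<gamma> z"
  let ?C3 = "case_C3 n r s t g (shifted_square zv) \<gamma> z"
  let ?J1 = "case_C1 n r s t g (convex_indicator {0..\<gamma>}) z"
  let ?J2 = "case_C2 n r s t g (convex_indicator {0..\<gamma>}) \<gamma> z"
  let ?J3 = "case_C3 n r s t g (convex_indicator {0..\<gamma>}) \<gamma> z"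
  have \<kappa>: "\<kappa> > 0" using t by (simp add: \<kappa>_def)
  have D: "D x = weighted_norm (r - t) \<kappa> x / \<tau>" for x
    unfolding D_def dual_rst_scaled_l2[OF t(2,3) \<tau>] by (simp add: \<kappa>_def)
  have Dz: "D z = ?N / \<tau>" by (simp add: D \<kappa>_def weighted_norm_def)
  have Pz: "primal_rst n r s t (\<lambda>x. \<tau> * l2 x) z = \<tau> * ?N'"
    by (simp add: primal_rst_scaled_l2[OF t] weighted_norm_def)
  have D_zero: "D (0\<^sub>v (r - t + 1)) = 0" by (simp add: D weighted_norm_zero)
  have D_nonneg: "D x \<ge> 0" for x using \<kappa> \<tau> by (simp add: D weighted_norm_nonneg)
  have D_eq_0: "x = 0\<^sub>v (r - t + 1)" if "x \<in> carrier_vec (r - t + 1)" "D x = 0" for x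
    using weighted_norm_eq_0_imp[OF \<kappa>, of x "r - t"] that \<tau> by (simp add: D)
  have C1_iff: "?C1 y w \<longleftrightarrow> y = z \<and> w = - zv \<and> ?N \<le> - \<tau> * zv" for y w
    using \<tau> by (auto simp: case_C1_def is_argmin_shifted_square Dz field_simps simp flip: D_def)
  have C2_iff: "?C2 y w \<longleftrightarrow> y = 0\<^sub>v (r - t + 1) \<and> w = 0 \<and> ?N' \<le> zv / \<tau>" for y w
    using \<tau> by (simp add: case_C2_def subdiff_shifted_square Pz field_simps)
  have J1_iff: "?J1 y w \<longleftrightarrow> y = z \<and> w = 1 \<and> ?N \<le> \<tau>" for y w
    using \<tau> by (auto simp: case_C1_def is_argmin_convex_indicator Dz simp flip: D_def)
  have C3_D: "w = D y" if "multiplier_C3 n r s t g f \<gamma> z y w \<mu>" for f y w \<mu>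
    using that by (simp add: multiplier_C3_def D_def)
  have C3_0: "y = z" if C3: "multiplier_C3 n r s t g f \<gamma> z y w 0" for f
  proof -
    obtain p where p: "p \<in> carrier_vec (r - t + 1)" "z - y = 0 \<cdot>\<^sub>v p"
      using C3 by (auto simp: multiplier_C3_def subdiff_vec_def)
    have "(z - y) $ i = 0" if "i < r - t + 1" for i using p that by simp
    then show ?thesis using zc yc by (intro eq_vecI) auto
  qed

  have "(?C1 y w \<longleftrightarrow> (y, w) = (z, - zv))
      \<and> ((y, w) = (z, - zv) \<longleftrightarrow> ?N \<le> - \<tau> * zv)
      \<and> (?C2 y w \<longleftrightarrow> (y, w) = (0\<^sub>v (r - t + 1), 0))
      \<and> ((y, w) = (0\<^sub>v (r - t + 1), 0) \<longleftrightarrow> ?N' \<le> zv / \<tau>)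
      \<and> (\<not> ?N \<le> - \<tau> * zv \<and> \<not> ?N' \<le> zv / \<tau>
          \<longrightarrow> (\<exists>\<mu>\<ge>0.
                multiplier_C3 n r s t g (shifted_square zv) \<gamma> z y w \<mu>
              \<and> (\<forall>y' w' \<mu>'. y' \<in> carrier_vec (r - t + 1) \<and>
                   multiplier_C3 n r s t g (shifted_square zv) \<gamma> z y' w' \<mu>' \<longrightarrow> \<mu>' = \<mu>)
              \<and> w = \<mu> - zv \<and> w > 0
              \<and> (\<forall>i < r - t. y $ i = z $ i / (1 + \<mu> / (\<tau>\<^sup>2 * w)))
              \<and> y $ (r - t) = z $ (r - t) / (1 + \<mu> * real t / (\<tau>\<^sup>2 * w * real (s + t)))
              \<and> quartic \<tau> s t c1 c2 w \<mu> = 0))"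
    if cases: "?C1 y w \<or> ?C2 y w \<or> ?C3 y w"
  proof -
    have sol: "variational_solution (r - t + 1) D zv z y' w'"
      if "y' \<in> carrier_vec (r - t + 1)" "?C1 y' w' \<or> ?C2 y' w' \<or> ?C3 y' w'" for y' w'
      using cases_shifted_square_imp_variational_solution[OF t \<tau> zc that(1)] that(2)
      by (simp add: D_def)
    have unique: "y' = y \<and> w' = w"
      if "y' \<in> carrier_vec (r - t + 1)" "?C1 y' w' \<or> ?C2 y' w' \<or> ?C3 y' w'" for y' w'
      using variational_solution_unique[OF zc sol[OF yc cases] sol[OF that]] by blast
    have N1: "(y, w) = (z, - zv) \<longleftrightarrow> ?N \<le> - \<tau> * zv"
    proof
      assume eq: "(y, w) = (z, - zv)"
      have "D y \<le> w" using sol[OF yc cases] by (simp add: variational_solution_def)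
      then have "?N / \<tau> \<le> - zv" using eq Dz by (simp only: prod.inject)
      then have "?N \<le> - zv * \<tau>" using \<tau> by (simp only: pos_divide_le_eq)
      also have "- zv * \<tau> = - \<tau> * zv" by simp
      finally show "?N \<le> - \<tau> * zv" .
    next
      assume "?N \<le> - \<tau> * zv"
      then have "?C1 z (- zv)" by (simp only: C1_iff)
      then show "(y, w) = (z, - zv)" using unique[OF zc] by blast
    qed
    have N2: "(y, w) = (0\<^sub>v (r - t + 1), 0) \<longleftrightarrow> ?N' \<le> zv / \<tau>"
    proof
      assume eq: "(y, w) = (0\<^sub>v (r - t + 1), 0)"
      from cases show "?N' \<le> zv / \<tau>"
      proof (elim disjE)
        assume "?C1 y w"
        then have "y = z \<and> w = - zv" using C1_iff by blast
        then have z: "z = 0\<^sub>v (r - t + 1)" "zv = 0" using eq by auto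
        show ?thesis unfolding z by simp
      next
        assume "?C2 y w" then show ?thesis by (simp only: C2_iff)
      next
        assume "?C3 y w"
        then obtain p where p: "p \<in> subdiff_vec (Suc (r - t)) (\<lambda>x. weighted_norm (r - t) \<kappa> x / \<tau>) y"
          and zy: "z - y = zv \<cdot>\<^sub>v p" and zv: "zv \<ge> 0"
          using eq by (auto simp: case_C3_def multiplier_C3_scaled_l2[OF t(2,3) \<tau>]
              subdiff_shifted_square \<kappa>_def)
        have pc: "p \<in> carrier_vec (Suc (r - t))" using p by (simp add: subdiff_vec_def)
        (* at y = 0 the multiplier is zv, so z = zv * p, and p has dual norm at most 1 *)
        have "z = z - y" using eq zc by auto
        then have "weighted_norm (r - t) (1 / \<kappa>) z = zv * weighted_norm (r - t) (1 / \<kappa>) p"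
          using zy zv \<kappa> pc by (metis weighted_norm_smult abs_of_nonneg less_imp_le zero_less_divide_1_iff)
        moreover have "\<tau> * weighted_norm (r - t) (1 / \<kappa>) p \<le> 1"
          using subgradient_weighted_norm(2)[OF \<kappa> \<tau> _ p] yc by simp
        then have "zv * (\<tau> * weighted_norm (r - t) (1 / \<kappa>) p) \<le> zv * 1"
          using zv by (rule mult_left_mono)
        ultimately have "weighted_norm (r - t) (1 / \<kappa>) z \<le> zv / \<tau>"
          using \<tau> by (simp add: field_simps)
        then show ?thesis by (simp add: weighted_norm_def \<kappa>_def)
      qed
    next
      assume "?N' \<le> zv / \<tau>"
      then have "?C2 (0\<^sub>v (r - t + 1)) 0" by (simp only: C2_iff)
      then show "(y, w) = (0\<^sub>v (r - t + 1), 0)"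
        using unique[of "0\<^sub>v (r - t + 1)" 0] by simp
    qed
    have "\<exists>\<mu>\<ge>0. multiplier_C3 n r s t g (shifted_square zv) \<gamma> z y w \<mu>
        \<and> (\<forall>y' w' \<mu>'. y' \<in> carrier_vec (r - t + 1) \<and>
             multiplier_C3 n r s t g (shifted_square zv) \<gamma> z y' w' \<mu>' \<longrightarrow> \<mu>' = \<mu>)
        \<and> w = \<mu> - zv \<and> w > 0
        \<and> (\<forall>i < r - t. y $ i = z $ i / (1 + \<mu> / (\<tau>\<^sup>2 * w)))
        \<and> y $ (r - t) = z $ (r - t) / (1 + \<mu> * real t / (\<tau>\<^sup>2 * w * real (s + t)))
        \<and> quartic \<tau> s t c1 c2 w \<mu> = 0"
      if neither: "\<not> ?N \<le> - \<tau> * zv" "\<not> ?N' \<le> zv / \<tau>"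
    proof -
      have "?C3 y w" using cases neither by (simp only: C1_iff C2_iff) blast
      then obtain \<mu> where \<mu>: "multiplier_C3 n r s t g (shifted_square zv) \<gamma> z y w \<mu>"
        unfolding case_C3_def by blast
      have mult: "\<mu>' = w' + zv"
        if "multiplier_C3 n r s t g (shifted_square zv) \<gamma> z y' w' \<mu>'" for y' w' \<mu>'
        using that by (simp add: multiplier_C3_def subdiff_shifted_square)
      (* w = D y vanishes only together with y, and that pair is the excluded case (C2) *)
      have "w \<noteq> 0"
      proof
        assume "w = 0"
        then have "y = 0\<^sub>v (r - t + 1)" using C3_D[OF \<mu>] D_eq_0[OF yc] by simp
        then show False using \<open>w = 0\<close> N2 neither by simp
      qed
      then have w: "w > 0" using C3_D[OF \<mu>] D_nonneg[of y] by simp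
      have \<mu>1: "multiplier_C3 n r s t (\<lambda>x. \<tau> * l2 x) (shifted_square zv) 1 z y w \<mu>"
        using \<mu> by simp
      note formulas = multiplier_C3_solution[OF t \<tau> zc yc w \<mu>1, unfolded c1 c2]
      have "\<mu>' = \<mu>" if "y' \<in> carrier_vec (r - t + 1)"
        "multiplier_C3 n r s t g (shifted_square zv) \<gamma> z y' w' \<mu>'" for y' w' \<mu>'
      proof -
        have "w' = w" using unique[OF that(1)] that(2) unfolding case_C3_def by blast
        then show ?thesis using mult[OF that(2)] mult[OF \<mu>] by simp
      qed
      moreover have "\<mu> \<ge> 0" using \<mu> by (simp add: multiplier_C3_def)
      moreover have "w = \<mu> - zv" using mult[OF \<mu>] by simp
      ultimately show ?thesis using \<mu> w formulas by blast
    qed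
    moreover have "?C1 y w \<longleftrightarrow> (y, w) = (z, - zv)" using N1 by (simp only: C1_iff prod.inject) blast
    moreover have "?C2 y w \<longleftrightarrow> (y, w) = (0\<^sub>v (r - t + 1), 0)"
      using N2 by (simp only: C2_iff prod.inject) blast
    ultimately show ?thesis using N1 N2 by blast
  qed
  moreover
  have "(?J1 y w \<or> ?J2 y w \<longleftrightarrow> (y, w) = (z, 1))
      \<and> ((y, w) = (z, 1) \<longleftrightarrow> ?N \<le> \<tau>)
      \<and> (\<not> ?N \<le> \<tau> \<longrightarrow> w = 1
            \<and> (\<exists>\<mu>\<ge>0.
                multiplier_C3 n r s t g (convex_indicator {0..\<gamma>}) \<gamma> z y w \<mu>
              \<and> (\<forall>i < r - t. y $ i = z $ i / (1 + \<mu> / \<tau>\<^sup>2))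
              \<and> y $ (r - t) = z $ (r - t) / (1 + \<mu> * real t / (\<tau>\<^sup>2 * real (s + t)))
              \<and> (\<forall>\<mu>'\<ge>0. quartic \<tau> s t c1 c2 1 \<mu>' = 0 \<longleftrightarrow> \<mu>' = \<mu>)))"
    if first: "cases_C1_first n r s t g (convex_indicator {0..\<gamma>}) \<gamma> z y w"
  proof -
    have first': "?J1 y w \<or> \<not> ?N \<le> \<tau> \<and> (?J2 y w \<or> ?J3 y w)"
      using first J1_iff unfolding cases_C1_first_def by blast
    (* here (C2) forces z = 0, since the subgradients of the indicator at 0 are nonpositive *)
    have J2: "?N \<le> \<tau>" if C2: "?J2 y w"
    proof -
      obtain \<mu> where "\<mu> \<in> subdiff (convex_indicator {0..1}) 0" "\<tau> * ?N' \<le> \<mu>"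
        using C2 by (auto simp: case_C2_def Pz)
      moreover from this have "\<mu> \<le> 0" using subdiff_convex_indicator(3) by fastforce
      ultimately have "?N' \<le> 0" using \<tau> by (smt (verit) mult_pos_pos)
      moreover have "weighted_norm (r - t) (1 / \<kappa>) z = ?N'"
        by (simp add: weighted_norm_def \<kappa>_def)
      ultimately have "weighted_norm (r - t) (1 / \<kappa>) z = 0"
        using weighted_norm_nonneg[of "1 / \<kappa>" "r - t" z] \<kappa> by simp
      then have "z = 0\<^sub>v (r - t + 1)"
        using weighted_norm_eq_0_imp[of "1 / \<kappa>" z "r - t"] \<kappa> zc by simp
      then have "?N / \<tau> = 0" using D_zero Dz by simp
      then show ?thesis using \<tau> by simp
    qed
    have N: "(y, w) = (z, 1) \<longleftrightarrow> ?N \<le> \<tau>"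
    proof
      assume eq: "(y, w) = (z, 1)"
      show "?N \<le> \<tau>"
      proof (rule ccontr)
        assume "\<not> ?N \<le> \<tau>"
        then have "?J3 y w" using first' J1_iff J2 by blast
        then have "w = D y" using C3_D unfolding case_C3_def by blast
        then have "?N / \<tau> \<le> 1" using eq Dz by (metis prod.inject order.refl)
        then show False using \<tau> \<open>\<not> ?N \<le> \<tau>\<close> by (simp only: pos_divide_le_eq mult_1_left)
      qed
    next
      assume "?N \<le> \<tau>"
      then have "?J1 y w" using first' by blast
      then show "(y, w) = (z, 1)" by (simp only: J1_iff)
    qed
    have "w = 1 \<and> (\<exists>\<mu>\<ge>0.
                multiplier_C3 n r s t g (convex_indicator {0..\<gamma>}) \<gamma> z y w \<mu>
              \<and> (\<forall>i < r - t. y $ i = z $ i / (1 + \<mu> / \<tau>\<^sup>2))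
              \<and> y $ (r - t) = z $ (r - t) / (1 + \<mu> * real t / (\<tau>\<^sup>2 * real (s + t)))
              \<and> (\<forall>\<mu>'\<ge>0. quartic \<tau> s t c1 c2 1 \<mu>' = 0 \<longleftrightarrow> \<mu>' = \<mu>))"
      if not: "\<not> ?N \<le> \<tau>"
    proof -
      have "?J3 y w" using first' J1_iff J2 not by blast
      then obtain \<mu> where \<mu>: "multiplier_C3 n r s t g (convex_indicator {0..\<gamma>}) \<gamma> z y w \<mu>"
        unfolding case_C3_def by blast
      have sub: "\<mu> \<in> subdiff (convex_indicator {0..1}) w" and "\<mu> \<ge> 0"
        using \<mu> unfolding multiplier_C3_def \<open>\<gamma> = 1\<close> by blast+
      (* a zero multiplier would make z itself feasible *)
      have "\<mu> \<noteq> 0"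
      proof
        assume "\<mu> = 0"
        then have "y = z" using \<mu> C3_0 by blast
        then have "?N / \<tau> \<le> 1"
          using C3_D[OF \<mu>] Dz subdiff_convex_indicator(2)[OF sub] by (simp only:)
        then show False using not \<tau> by (simp only: pos_divide_le_eq mult_1_left)
      qed
      then have w: "w = 1"
        using subdiff_convex_indicator[OF sub] \<open>\<mu> \<ge> 0\<close> by (smt (verit) mult_pos_pos)
      have one: "(0::real) < 1" by simp
      have "multiplier_C3 n r s t (\<lambda>x. \<tau> * l2 x) (convex_indicator {0..1}) 1 z y 1 \<mu>"
        using \<mu> w by simp
      note formulas = multiplier_C3_solution[OF t \<tau> zc yc one this, unfolded c1 c2 mult_1_right]
      have "c1 \<ge> 0" unfolding c1[symmetric] by (intro sum_nonneg) auto
      then have "\<mu>' = \<mu>" if "\<mu>' \<ge> 0" "quartic \<tau> s t c1 c2 1 \<mu>' = 0" for \<mu>'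
        using quartic_root_unique[OF t(1) \<tau> one _ \<open>\<mu> \<ge> 0\<close> formulas(3) that] by blast
      then show ?thesis using w \<mu> \<open>\<mu> \<ge> 0\<close> formulas by blast
    qed
    moreover have "?J1 y w \<or> ?J2 y w \<longleftrightarrow> (y, w) = (z, 1)"
      using first' N J2 J1_iff by blast
    ultimately show ?thesis using N by blast
  qed
  ultimately show ?thesis by blast
qed

end
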